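(* Let $G$ be a finite connected graph without loops or multiple edges, with $m=|E(G)|$, let ${\bf W}$ be a quaternionic weighted matrix of $G$, and enumerate the arcs as $D(G)=\{e_1,e_2,\ldots,e_{2m}\}$. Let $t$ be a quaternion with $|t|$ sufficiently small (i.e. $|t|<\varepsilon$ for some $\varepsilon>0$ depending only on $G$ and ${\bf W}$). Then $$ {\bf Z}^{\mathbb{H}}_1(G,w,t)=\prod_{i_1i_2\cdots i_d\in L_{[2m]}}\bigl|1-t\tilde{w}(e_{i_1},e_{i_2})\,t\tilde{w}(e_{i_2},e_{i_3})\cdots t\tilde{w}(e_{i_d},e_{i_1})\bigr|^{-2}, $$ where the product runs over all Lyndon words $i_1i_2\cdots i_d$ (of all lengths $d\ge 1$) over the ordered alphabet $[2m]=\{1,2,\ldots,2m\}$.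
   Context: $\mathbb{H}$ is the skew field of quaternions with $\mathbb{R}$-basis $1,i,j,k$; $|x|=\sqrt{xx^*}$ is the quaternion norm. For a quaternionic matrix ${\bf M}$ and $t\in\mathbb{H}$, $t{\bf M}$ is obtained by multiplying every entry by $t$ on the left. Study determinant: every $p\times p$ quaternionic matrix ${\bf M}$ is written uniquely as ${\bf M}={\bf M}^S+j{\bf M}^P$ with ${\bf M}^S,{\bf M}^P$ complex matrices. Put $\psi({\bf M})=\begin{bmatrix}{\bf M}^S&-\overline{{\bf M}^P}\\ {\bf M}^P&\overline{{\bf M}^S}\end{bmatrix}$ and $\operatorname{Sdet}({\bf M})=\det(\psi({\bf M}))$, with $\det$ the ordinary determinant. Graph notation: $V(G)$ is the vertex set, $E(G)$ the set of undirected edges, and $D(G)=\{(u,v),(v,u)\mid uv\in E(G)\}$ the set of arcs, so $|D(G)|=2m$. For $e=(u,v)\in D(G)$, $o(e)=u$, $t(e)=v$, $e^{-1}=(v,u)$. A quaternionic weighted matrix of $G$ is a quaternionic matrix ${\bf W}=({\bf W}_{uv})_{u,v\in V(G)}$ with ${\bf W}_{uv}=0$ whenever $(u,v)\notin D(G)$; put $w(u,v)={\bf W}_{uv}$ and $w(e)=w(u,v)$ for $e=(u,v)\in D(G)$. Let ${\bf B}_w=({\bf B}^{(w)}_{ef})_{e,f\in D(G)}$ with ${\bf B}^{(w)}_{ef}=w(f)$ if $t(e)=o(f)$ and $0$ otherwise, and ${\bf J}_0=({\bf J}_{ef})_{e,f\in D(G)}$ with ${\bf J}_{ef}=1$ if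 $f=e^{-1}$ and $0$ otherwise. The quaternionic second weighted zeta function of $G$ is ${\bf Z}^{\mathbb{H}}_1 (G,w,t)= \operatorname{Sdet} ( {\bf I}_{2m} -t ( {\bf B}_w - {\bf J}_0 ) )^{-1}$. $\tilde{w}(e,f)$ denotes the $(e,f)$-entry of ${\bf B}_w-{\bf J}_0$: it equals $w(f)$ if $t(e)=o(f)$ and $f\neq e^{-1}$; $w(f)-1$ if $f=e^{-1}$; and $0$ otherwise. For a finite totally ordered set $X$, $X^*$ is the free monoid of words on $X$ with the lexicographic order. A nonempty word is a Lyndon word if it is prime (not a power $v^r$ of another word $v$ with $r\ge2$) and is minimal among its cyclic rearrangements. $L_X$ is the set of Lyndon words in $X^*$; $[2m]$ carries the natural order. For $d=1$ the factor is $|1-t\tilde w(e_{i_1},e_{i_1})|^{-2}$. *)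

theory Defs
  imports
    Complex_Main
    "Graph_Theory.Graph_Theory"
    "Jordan_Normal_Form.Determinant"
begin

section \<open>Quaternions\<close>

text \<open>\<open>Quat a b c d\<close> stands for \<open>a + b i + c j + d k\<close>, with \<open>k = i j\<close>.\<close>

datatype quat = Quat (qRe: real) (qI: real) (qJ: real) (qK: real)

lemma quat_eqI:
  "\<lbrakk>qRe x = qRe y; qI x = qI y; qJ x = qJ y; qK x = qK y\<rbrakk> \<Longrightarrow> x = y"
  by (cases x; cases y) simp

lemma quat_eq_iff:
  "x = y \<longleftrightarrow> qRe x = qRe y \<and> qI x = qI y \<and> qJ x = qJ y \<and> qK x = qK y"
  by (auto intro: quat_eqI)

instantiation quat :: real_vector
begin

definition "0 = Quat 0 0 0 0"
definition "x + y = Quat (qRe x + qRe y) (qI x + qI y) (qJ x + qJ y) (qK x + qK y)"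
definition "- x = Quat (- qRe x) (- qI x) (- qJ x) (- qK x)"
definition "x - y = Quat (qRe x - qRe y) (qI x - qI y) (qJ x - qJ y) (qK x - qK y)"
definition "scaleR r x = Quat (r * qRe x) (r * qI x) (r * qJ x) (r * qK x)"

instance
  by standard
    (simp_all add: quat_eq_iff zero_quat_def plus_quat_def uminus_quat_def minus_quat_def
      scaleR_quat_def algebra_simps)

end

definition qcnj :: "quat \<Rightarrow> quat" where
  "qcnj x = Quat (qRe x) (- qI x) (- qJ x) (- qK x)"

definition qnorm2 :: "quat \<Rightarrow> real" where
  "qnorm2 x = (qRe x)\<^sup>2 + (qI x)\<^sup>2 + (qJ x)\<^sup>2 + (qK x)\<^sup>2"

lemma qnorm2_eq_0_iff: "qnorm2 x = 0 \<longleftrightarrow> x = 0"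
  by (simp add: qnorm2_def quat_eq_iff zero_quat_def add_nonneg_eq_0_iff)

lemma qnorm2_nonneg: "0 \<le> qnorm2 x"
  by (simp add: qnorm2_def)

instantiation quat :: real_div_algebra
begin

definition "1 = Quat 1 0 0 0"
definition "x * y = Quat
  (qRe x * qRe y - qI x * qI y - qJ x * qJ y - qK x * qK y)
  (qRe x * qI y + qI x * qRe y + qJ x * qK y - qK x * qJ y)
  (qRe x * qJ y - qI x * qK y + qJ x * qRe y + qK x * qI y)
  (qRe x * qK y + qI x * qJ y - qJ x * qI y + qK x * qRe y)"
definition "inverse x = scaleR (1 / qnorm2 x) (qcnj x)"
definition "x div (y :: quat) = x * inverse y"

instance
proof
  fix x y z :: quat and r :: real
  show "x * y * z = x * (y * z)"
    by (simp add: times_quat_def quat_eq_iff algebra_simps)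
  show "(x + y) * z = x * z + y * z" "x * (y + z) = x * y + x * z"
    by (simp_all add: times_quat_def plus_quat_def quat_eq_iff algebra_simps)
  show "1 * x = x" "x * 1 = x" "(0::quat) \<noteq> 1"
    by (simp_all add: times_quat_def one_quat_def zero_quat_def quat_eq_iff)
  show "scaleR r x * y = scaleR r (x * y)" "x * scaleR r y = scaleR r (x * y)"
    by (simp_all add: times_quat_def scaleR_quat_def quat_eq_iff algebra_simps)
  show "x div y = x * inverse y"
    by (rule divide_quat_def)
  show "inverse (0::quat) = 0"
    by (simp add: inverse_quat_def qnorm2_def zero_quat_def scaleR_quat_def qcnj_def)
  assume "x \<noteq> 0"
  then have n: "qnorm2 x \<noteq> 0" by (simp add: qnorm2_eq_0_iff)
  have "qcnj x * x = scaleR (qnorm2 x) 1" "x * qcnj x = scaleR (qnorm2 x) 1"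
    by (simp_all add: times_quat_def qcnj_def scaleR_quat_def one_quat_def quat_eq_iff
        qnorm2_def power2_eq_square algebra_simps)
  moreover have "inverse x * x = scaleR (1 / qnorm2 x) (qcnj x * x)"
    "x * inverse x = scaleR (1 / qnorm2 x) (x * qcnj x)"
    by (simp_all add: inverse_quat_def times_quat_def scaleR_quat_def quat_eq_iff algebra_simps)
  ultimately show "inverse x * x = 1" "x * inverse x = 1"
    using n by simp_all
qed

end

instantiation quat :: real_normed_div_algebra
begin

definition "norm x = sqrt (qnorm2 x)"
definition "sgn x = scaleR (inverse (norm x)) (x :: quat)"
definition "dist x y = norm (x - y :: quat)"
definition [code del]:
  "(uniformity :: (quat \<times> quat) filter) = (INF e\<in>{0 <..}. principal {(x, y). dist x y < e})"
definition [code del]: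
  "open (U :: quat set) \<longleftrightarrow> (\<forall>x\<in>U. eventually (\<lambda>(x', y). x' = x \<longrightarrow> y \<in> U) uniformity)"

instance
proof
  fix x y :: quat and r :: real and U :: "quat set"
  show "dist x y = norm (x - y)" by (rule dist_quat_def)
  show "sgn x = scaleR (inverse (norm x)) x" by (rule sgn_quat_def)
  show "(uniformity :: (quat \<times> quat) filter) = (INF e\<in>{0 <..}. principal {(x, y). dist x y < e})"
    by (rule uniformity_quat_def)
  show "open U \<longleftrightarrow> (\<forall>x\<in>U. eventually (\<lambda>(x', y). x' = x \<longrightarrow> y \<in> U) uniformity)"
    by (rule open_quat_def)
  show "norm x = 0 \<longleftrightarrow> x = 0"
    by (simp add: norm_quat_def qnorm2_eq_0_iff)
  show "norm (scaleR r x) = \<bar>r\<bar> * norm x"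
  proof -
    have "qnorm2 (scaleR r x) = r\<^sup>2 * qnorm2 x"
      by (simp add: qnorm2_def scaleR_quat_def power_mult_distrib algebra_simps)
    then show ?thesis by (simp add: norm_quat_def real_sqrt_mult)
  qed
  show "norm (x * y) = norm x * norm y"
  proof -
    have "qnorm2 (x * y) = qnorm2 x * qnorm2 y"
      by (simp add: qnorm2_def times_quat_def power2_eq_square algebra_simps)
    then show ?thesis by (simp add: norm_quat_def real_sqrt_mult)
  qed
  show "norm (x + y) \<le> norm x + norm y"
  proof -
    have eq: "norm z = sqrt ((cmod (Complex (qRe z) (qI z)))\<^sup>2 + (cmod (Complex (qJ z) (qK z)))\<^sup>2)"
      for z :: quat
      by (simp add: norm_quat_def qnorm2_def cmod_power2 add.assoc)
    let ?a = "\<lambda>z. Complex (qRe z) (qI z)" and ?b = "\<lambda>z. Complex (qJ z) (qK z)"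
    have "norm (x + y) = sqrt ((cmod (?a x + ?a y))\<^sup>2 + (cmod (?b x + ?b y))\<^sup>2)"
      by (simp add: eq plus_quat_def complex_add)
    also have "\<dots> \<le> sqrt ((cmod (?a x) + cmod (?a y))\<^sup>2 + (cmod (?b x) + cmod (?b y))\<^sup>2)"
      by (intro real_sqrt_le_mono add_mono power_mono norm_triangle_ineq norm_ge_zero)
    also have "\<dots> \<le> norm x + norm y"
      unfolding eq by (rule real_sqrt_sum_squares_triangle_ineq)
    finally show ?thesis .
  qed
qed

end

lemma quat_mult_cnj: "x * qcnj x = of_real ((norm x)\<^sup>2)"
  by (simp add: norm_quat_def qnorm2_nonneg of_real_def)
    (simp add: times_quat_def qcnj_def scaleR_quat_def one_quat_def quat_eq_iff
        qnorm2_def power2_eq_square algebra_simps)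


section \<open>The Study determinant\<close>

definition quat_of_complex :: "complex \<Rightarrow> quat" where
  "quat_of_complex z = Quat (Re z) (Im z) 0 0"

definition quat_j :: quat where
  "quat_j = Quat 0 0 1 0"

text \<open>The complex numbers \<open>S\<close>, \<open>P\<close> with \<open>x = S + j P\<close>; the sign in \<open>qP\<close> comes from \<open>j i = - k\<close>.\<close>

definition qS :: "quat \<Rightarrow> complex" where
  "qS x = Complex (qRe x) (qI x)"

definition qP :: "quat \<Rightarrow> complex" where
  "qP x = Complex (qJ x) (- qK x)"

lemma quat_eq_S_plus_j_P_iff:
  "x = quat_of_complex a + quat_j * quat_of_complex b \<longleftrightarrow> a = qS x \<and> b = qP x"
  by (auto simp: quat_eq_iff complex_eq_iff quat_of_complex_def quat_j_def qS_def qP_def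
      plus_quat_def times_quat_def)

definition study_psi :: "quat mat \<Rightarrow> complex mat" where
  "study_psi M = four_block_mat
     (map_mat qS M) (- map_mat cnj (map_mat qP M))
     (map_mat qP M) (map_mat cnj (map_mat qS M))"

definition Sdet :: "quat mat \<Rightarrow> complex" where
  "Sdet M = det (study_psi M)"


section \<open>Graphs and quaternionic weights\<close>

text \<open>
  A finite simple graph is a locale instance \<open>pair_graph G\<close>: a finite loopless digraph whose set
  of arcs \<open>parcs G\<close> is a symmetric set of ordered pairs. Thus \<open>parcs G\<close> is \<open>D(G)\<close>.
\<close>

definition uedges :: "'v pair_pre_digraph \<Rightarrow> 'v set set" where
  "uedges G = {{u, v} |u v. (u, v) \<in> parcs G}"

definition weighted_matrix :: "'v pair_pre_digraph \<Rightarrow> ('v \<Rightarrow> 'v \<Rightarrow> quat) \<Rightarrow> bool" where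
  "weighted_matrix G W \<longleftrightarrow>
     (\<forall>u\<in>pverts G. \<forall>v\<in>pverts G. (u, v) \<notin> parcs G \<longrightarrow> W u v = 0)"

definition Bw :: "('v \<Rightarrow> 'v \<Rightarrow> quat) \<Rightarrow> 'v \<times> 'v \<Rightarrow> 'v \<times> 'v \<Rightarrow> quat" where
  "Bw W e f = (if snd e = fst f then W (fst f) (snd f) else 0)"

definition J0 :: "'v \<times> 'v \<Rightarrow> 'v \<times> 'v \<Rightarrow> quat" where
  "J0 e f = (if f = (snd e, fst e) then 1 else 0)"

definition wtilde :: "('v \<Rightarrow> 'v \<Rightarrow> quat) \<Rightarrow> 'v \<times> 'v \<Rightarrow> 'v \<times> 'v \<Rightarrow> quat" where
  "wtilde W e f = Bw W e f - J0 e f"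

text \<open>
  Arcs are enumerated as \<open>a 1, \<dots>, a n\<close>, whereas indices of type \<open>mat\<close> start at \<open>0\<close>.
\<close>

definition arc_mat :: "nat \<Rightarrow> (nat \<Rightarrow> 'v \<times> 'v) \<Rightarrow> ('v \<times> 'v \<Rightarrow> 'v \<times> 'v \<Rightarrow> quat) \<Rightarrow> quat mat" where
  "arc_mat n a K = mat n n (\<lambda>(i, j). K (a (Suc i)) (a (Suc j)))"

definition zeta_mat ::
  "'v pair_pre_digraph \<Rightarrow> ('v \<Rightarrow> 'v \<Rightarrow> quat) \<Rightarrow> (nat \<Rightarrow> 'v \<times> 'v) \<Rightarrow> quat \<Rightarrow> quat mat" where
  "zeta_mat G W a t =
     (let n = 2 * card (uedges G)
      in 1\<^sub>m n - t \<cdot>\<^sub>m (arc_mat n a (Bw W) - arc_mat n a J0))"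

text \<open>
  The enumeration \<open>a\<close> of the arcs only fixes the order of rows and columns; it does not affect the
  value.
\<close>

definition zeta_H ::
  "'v pair_pre_digraph \<Rightarrow> ('v \<Rightarrow> 'v \<Rightarrow> quat) \<Rightarrow> (nat \<Rightarrow> 'v \<times> 'v) \<Rightarrow> quat \<Rightarrow> complex" where
  "zeta_H G W a t = inverse (Sdet (zeta_mat G W a t))"


section \<open>Lyndon words\<close>

definition prime_word :: "'a list \<Rightarrow> bool" where
  "prime_word w \<longleftrightarrow> \<not> (\<exists>v r. r \<ge> 2 \<and> w = concat (replicate r v))"

definition lyndon_words :: "'a::linorder set \<Rightarrow> 'a list set" where
  "lyndon_words X =
     {w \<in> lists X. w \<noteq> [] \<and> prime_word w \<and> (\<forall>k. lexordp_eq w (rotate k w))}"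

text \<open>
  For \<open>w = [i\<^sub>1, \<dots>, i\<^sub>d]\<close> this is the product, in this order, of the \<open>t * wtilde W (a i\<^sub>r) (a i\<^sub>r\<^sub>+\<^sub>1)\<close>
  for \<open>r = 1, \<dots>, d\<close>, where \<open>i\<^sub>d\<^sub>+\<^sub>1 = i\<^sub>1\<close>.
\<close>

definition cyclic_weight ::
  "('v \<Rightarrow> 'v \<Rightarrow> quat) \<Rightarrow> (nat \<Rightarrow> 'v \<times> 'v) \<Rightarrow> quat \<Rightarrow> nat list \<Rightarrow> quat" where
  "cyclic_weight W a t w =
     prod_list (map (\<lambda>(i, j). t * wtilde W (a i) (a j)) (zip w (rotate1 w)))"


section \<open>Products over countable index sets\<close>

text \<open>
  Unordered convergence, the multiplicative analogue of \<open>has_sum\<close>. As usual for infinite products,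
  the value is required to be nonzero, so no factor vanishes.
\<close>

definition has_set_prod :: "('i \<Rightarrow> 'a::real_normed_field) \<Rightarrow> 'i set \<Rightarrow> 'a \<Rightarrow> bool" where
  "has_set_prod f A p \<longleftrightarrow> p \<noteq> 0 \<and> (prod f \<longlongrightarrow> p) (finite_subsets_at_top A)"

end

theory Submission
  imports
    "HOL-Analysis.Complex_Transcendental"
    Defs
    "Jordan_Normal_Form.Schur_Decomposition"
begin

text \<open>
  Write \<open>A\<close> for the matrix with entries \<open>t * wtilde W (a i) (a j)\<close> and, for a word
  \<open>w = i\<^sub>1 \<dots> i\<^sub>d\<close>, write \<open>c(w)\<close> for the product of the entries of \<open>A\<close> along the closed walk
  \<open>i\<^sub>1, \<dots>, i\<^sub>d, i\<^sub>1\<close>. For small \<open>t\<close> the family \<open>Re c(w) / length w\<close>, indexed by all nonempty words \<open>w\<close>,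
  is absolutely summable, since there are \<open>n\<^sup>d\<close> words of length \<open>d\<close> and \<open>c(w)\<close> has norm at most \<open>q\<^sup>d\<close>,
  where \<open>n\<close> is the number of arcs and \<open>q\<close> bounds the entries. The formula results from computing its
  sum \<open>S\<close> in two ways.

  Grouping words by length, the words of length \<open>k\<close> contribute \<open>Re tr (A\<^sup>k) / k\<close>, which is half of
  \<open>tr (\<psi>(A)\<^sup>k) / k\<close> because \<open>\<psi>\<close> is multiplicative and \<open>tr (\<psi>(B)) = 2 * Re (tr B)\<close>
  (\<open>study_psi_mult\<close>, \<open>mtrace_study_psi\<close>). By \<open>det_one_minus_eq_exp_trace\<close> it follows that
  \<open>Sdet (1 - A) = exp (- 2 S)\<close>.

  Grouping words by Lyndon word, every nonempty word is a rotation of a power \<open>l\<^sup>r\<close> of a Lyndon word,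
  with \<open>l\<close>, \<open>r\<close> and the rotation by less than \<open>length l\<close> uniquely determined
  (\<open>bij_betw_lyndon_power_rotations\<close>). Quaternions do not commute, but \<open>Re (x y) = Re (y x)\<close>, so
  \<open>Re c\<close> is the same for all \<open>length l\<close> rotations, and \<open>c(l\<^sup>r) = c(l)\<^sup>r\<close>. Hence \<open>l\<close> contributes the sum
  of \<open>Re (c(l)\<^sup>r) / r\<close> over \<open>r \<ge> 1\<close>, which is \<open>- ln \<bar>1 - c(l)\<bar>\<close> (\<open>ln_norm_one_minus_sums\<close>). The
  product over Lyndon words is the exponential of twice this sum, that is \<open>exp (2 S)\<close>; unconditional
  convergence of the sum gives unordered convergence of the product.
\<close>


section \<open>Every word is a rotation of a power of a unique Lyndon word\<close>

lemma rotate1_concat_replicate: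
  "rotate1 (concat (replicate r v)) = concat (replicate r (rotate1 v))"
proof (cases v)
  case (Cons x xs)
  have "concat (replicate r (x # xs)) @ [x] = x # concat (replicate r (xs @ [x]))" for r
    by (induction r) auto
  then show ?thesis
    using Cons by (cases r) auto
qed (induction r, auto)

lemma rotate_concat_replicate:
  "rotate n (concat (replicate r v)) = concat (replicate r (rotate n v))"
  by (induction n) (simp_all add: rotate1_concat_replicate)

lemma length_concat_replicate: "length (concat (replicate r v)) = r * length v"
  by (induction r) auto

lemma nth_concat_replicate:
  "k < r * length v \<Longrightarrow> concat (replicate r v) ! k = v ! (k mod length v)"
proof (induction r arbitrary: k)
  case (Suc r)
  show ?case
  proof (cases "k < length v")
    case False
    then have "concat (replicate r v) ! (k - length v) = v ! ((k - length v) mod length v)"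
      using Suc.prems by (intro Suc.IH) auto
    then show ?thesis using False by (simp add: nth_append flip: le_mod_geq)
  qed (simp add: nth_append)
qed simp

text \<open>
  A common power \<open>W\<close> of \<open>u\<close> and \<open>v\<close>, read cyclically, is an infinite word with both periods
  \<open>length u\<close> and \<open>length v\<close>. Its prefix of length \<open>length u + length v\<close> is then \<open>u @ v\<close> as well as
  \<open>v @ u\<close>.
\<close>

lemma concat_replicate_eq_imp_commute:
  assumes eq: "concat (replicate r u) = concat (replicate s v)" and "r > 0" "s > 0"
  shows "u @ v = v @ u"
proof (cases "u = [] \<or> v = []")
  case True
  then show ?thesis using assms by auto
next
  case False
  let ?W = "concat (replicate r u)"
  have len: "length ?W = r * length u" "length ?W = s * length v"
    by (rule length_concat_replicate, subst eq, rule length_concat_replicate)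
  have W0: "length ?W > 0" using False assms by (simp add: len)
  \<comment> \<open>both sides are the letter in position \<open>k\<close> of the periodic word \<open>WWW\<dots>\<close>\<close>
  have per: "u ! (k mod length u) = v ! (k mod length v)" for k
  proof -
    have "k mod length ?W < length ?W" using W0 by simp
    then have "?W ! (k mod length ?W) = u ! (k mod length ?W mod length u)"
      "?W ! (k mod length ?W) = v ! (k mod length ?W mod length v)"
      using nth_concat_replicate[of "k mod length ?W" r u]
        nth_concat_replicate[of "k mod length ?W" s v]
      by (simp_all only: len(1)[symmetric] len(2)[symmetric] eq[symmetric])
    moreover have "k mod length ?W mod length u = k mod length u"
      by (rule mod_mod_cancel) (simp only: len(1) dvd_triv_right)
    moreover have "k mod length ?W mod length v = k mod length v"
      by (rule mod_mod_cancel) (simp only: len(2) dvd_triv_right)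
    ultimately show ?thesis by simp
  qed
  have nth: "(x @ y) ! k = x ! (k mod length x)"
    if "\<And>k. x ! (k mod length x) = y ! (k mod length y)" "k < length (x @ y)" for x y :: "'a list" and k
  proof (cases "k < length x")
    case False
    then have "(x @ y) ! k = y ! ((k - length x) mod length y)"
      using that(2) by (simp add: nth_append)
    also have "\<dots> = x ! ((k - length x) mod length x)" by (simp only: that(1))
    finally show ?thesis using False by (simp flip: le_mod_geq)
  qed (simp add: nth_append)
  have "(u @ v) ! k = (v @ u) ! k" if "k < length (u @ v)" for k
    using nth[of u v k] nth[of v u k] per that by simp
  then show ?thesis by (intro nth_equalityI) auto
qed

text \<open>
  Commuting words are powers of a common word, and a prime word is only a first power.
\<close>

lemma prime_word_commute_imp_eq:
  assumes "prime_word u" "prime_word v" "u @ v = v @ u"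
  shows "u = v"
proof -
  obtain m n zs where z: "concat (replicate m zs) = u" "concat (replicate n zs) = v"
    using comm_append_are_replicate[OF assms(3)] by blast
  \<comment> \<open>the empty word is not prime either, being \<open>[]\<close> squared\<close>
  have one: "k = 1" if "prime_word (concat (replicate k zs))" for k
  proof (rule ccontr)
    assume "k \<noteq> 1"
    then consider "k = 0" | "k \<ge> 2" by linarith
    then show False
    proof cases
      case 1
      have "concat (replicate 0 zs) = concat (replicate 2 [])" by simp
      then show False using that 1 unfolding prime_word_def by blast
    qed (use that in \<open>auto simp: prime_word_def\<close>)
  qed
  show ?thesis using one[of m] one[of n] assms(1,2) z by auto
qed

lemma prime_word_not_Nil: "prime_word w \<Longrightarrow> w \<noteq> []"
proof
  assume "prime_word w" "w = []"
  moreover have "[] = concat (replicate 2 [])" by simp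
  ultimately show False unfolding prime_word_def by blast
qed

lemma rotate_inverse: "\<exists>k. rotate k (rotate n w) = w"
proof (cases "w = []")
  case False
  then have "n \<le> length w * n" by (cases w) auto
  then have "rotate (length w * n - n) (rotate n w) = w"
    by (simp add: rotate_rotate)
  then show ?thesis by blast
qed simp

lemma prime_word_rotate: "prime_word w \<Longrightarrow> prime_word (rotate n w)"
  unfolding prime_word_def using rotate_inverse[of n w]
  by (metis rotate_concat_replicate)

text \<open>
  A rotation fixing \<open>w\<close> makes the two pieces into which it cuts \<open>w\<close> commute, so that \<open>w\<close> is a
  proper power unless one piece is empty.
\<close>

lemma prime_word_rotate_eq_imp_0:
  assumes "prime_word w" "rotate k w = w" "k < length w"
  shows "k = 0"
proof (rule ccontr)
  assume "k \<noteq> 0"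
  let ?x = "take k w" and ?y = "drop k w"
  have "?y @ ?x = ?x @ ?y"
    using assms rotate_drop_take[of k w] by simp
  from comm_append_is_replicate[OF _ _ this]
  obtain n zs where "n > 1" "concat (replicate n zs) = ?y @ ?x"
    using assms \<open>k \<noteq> 0\<close> prime_word_not_Nil[of w] by auto
  then have "n \<ge> 2" "w = concat (replicate n zs)"
    using \<open>?y @ ?x = ?x @ ?y\<close> by simp_all
  then show False using assms(1) unfolding prime_word_def by blast
qed

lemma ex_prime_root:
  assumes "w \<noteq> []"
  shows "\<exists>v r. prime_word v \<and> r > 0 \<and> w = concat (replicate r v)"
  using assms
proof (induction w rule: length_induct)
  case (1 w)
  show ?case
  proof (cases "prime_word w")
    case True
    then show ?thesis by (intro exI[of _ w] exI[of _ 1]) simp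
  next
    case False
    then obtain v r where r: "r \<ge> 2" and w: "w = concat (replicate r v)"
      unfolding prime_word_def by blast
    have "v \<noteq> []" using w 1 by auto
    moreover have "length v < length w"
      using r \<open>v \<noteq> []\<close> by (simp add: w length_concat_replicate)
    ultimately obtain u s where u: "prime_word u" "s > 0" "v = concat (replicate s u)"
      using 1 by blast
    have "concat (replicate k v) = concat (replicate (k * s) u)" for k
      by (induction k) (simp_all add: u(3) replicate_add)
    then show ?thesis using u w r
      by (intro exI[of _ u] exI[of _ "r * s"]) auto
  qed
qed

lemma ex_min_rotation:
  fixes w :: "'a::linorder list"
  shows "\<exists>i. \<forall>k. lexordp_eq (rotate i w) (rotate k (rotate i w))"
proof -
  have min: "\<exists>x\<in>S. \<forall>y\<in>S. lexordp_eq x y" if "finite S" "S \<noteq> {}" for S :: "'a list set"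
    using that
  proof (induction rule: finite_ne_induct)
    case (insert x F)
    then obtain y where y: "y \<in> F" "\<forall>z\<in>F. lexordp_eq y z" by blast
    show ?case
      using lexordp_eq_linear[of x y] y lexordp_eq_trans[of x y] lexordp_eq_refl[of x] by blast
  qed (simp add: lexordp_eq_refl)
  let ?S = "range (\<lambda>i. rotate i w)"
  have "?S \<subseteq> {x. set x \<subseteq> set w \<and> length x = length w}" by auto
  then have "finite ?S" using finite_lists_length_eq finite_subset by blast
  from min[OF this] obtain i where "\<forall>k. lexordp_eq (rotate i w) (rotate k w)" by auto
  then show ?thesis by (intro exI[of _ i]) (simp add: rotate_rotate)
qed

lemma lyndon_rotate_eq_imp_eq:
  assumes "l \<in> lyndon_words X" "l' \<in> lyndon_words X" "rotate i l = rotate j l'"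
  shows "l = l'"
proof -
  obtain a b where "rotate a (rotate i l) = l" "rotate b (rotate j l') = l'"
    using rotate_inverse by metis
  then have ll: "rotate (a + j) l' = l" "rotate (b + i) l = l'"
    using assms(3) by (metis rotate_rotate)+
  moreover have "lexordp_eq l (rotate k l)" "lexordp_eq l' (rotate k l')" for k
    using assms by (auto simp: lyndon_words_def)
  ultimately have "lexordp_eq l l'" "lexordp_eq l' l" by (metis ll)+
  then show ?thesis by (rule lexordp_eq_antisym)
qed

text \<open>
  Every nonempty word is a rotation of exactly one power of exactly one Lyndon word \<open>l\<close>, and the
  rotation is unique among those by less than \<open>length l\<close>. This is the re-indexing that turns a sum
  over words into a sum over Lyndon words, powers and rotations. The exponent is written \<open>Suc r\<close>, so
  that it starts at \<open>1\<close> while \<open>r\<close> runs through all natural numbers, as the index of a series does.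
\<close>

lemma bij_betw_lyndon_power_rotations:
  "bij_betw (\<lambda>(l, r, i). rotate i (concat (replicate (Suc r) l)))
     (SIGMA l:lyndon_words X. UNIV \<times> {..<length l}) (lists X - {[]})"
  (is "bij_betw ?f ?D ?R")
  unfolding bij_betw_def
proof (intro conjI subset_antisym)
  show "inj_on ?f ?D"
  proof (rule inj_onI)
    fix p p' assume D: "p \<in> ?D" "p' \<in> ?D" and fp: "?f p = ?f p'"
    obtain l r i l' r' i' where p: "p = (l, r, i)" "p' = (l', r', i')"
      by (metis prod_cases3)
    have L: "l \<in> lyndon_words X" "l' \<in> lyndon_words X"
      and i: "i < length l" "i' < length l'"
      and "rotate i (concat (replicate (Suc r) l)) = rotate i' (concat (replicate (Suc r') l'))"
      using D fp by (simp_all add: p del: replicate_Suc)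
    then have eq: "concat (replicate (Suc r) (rotate i l)) = concat (replicate (Suc r') (rotate i' l'))"
      by (simp only: rotate_concat_replicate)
    have pr: "prime_word l" "prime_word l'" using L by (auto simp: lyndon_words_def)
    \<comment> \<open>rotating a power rotates its base, so equal words have equal prime bases\<close>
    have u: "rotate i l = rotate i' l'"
    proof (rule prime_word_commute_imp_eq)
      show "prime_word (rotate i l)" "prime_word (rotate i' l')"
        using pr by (simp_all add: prime_word_rotate)
      show "rotate i l @ rotate i' l' = rotate i' l' @ rotate i l"
        by (intro concat_replicate_eq_imp_commute[OF eq]) simp_all
    qed
    with L have ll: "l = l'" by (rule lyndon_rotate_eq_imp_eq)
    have "Suc r * length l = Suc r' * length l"
      using arg_cong[OF eq, of length] by (simp only: length_concat_replicate length_rotate ll)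
    then have "r = r'" using i by auto
    have inj: "a = b" if "a \<le> b" "b < length l" "rotate a l = rotate b l" for a b
    proof -
      have "rotate (b - a) (rotate a l) = rotate b l"
        using that(1) by (simp add: rotate_rotate)
      then have "rotate (b - a) (rotate a l) = rotate a l" by (simp only: that(3))
      then have "b - a = 0"
        using that pr by (intro prime_word_rotate_eq_imp_0[of "rotate a l"] prime_word_rotate) auto
      then show ?thesis using that by simp
    qed
    have "i = i'" using inj[of i i'] inj[of i' i] u i ll by (cases "i \<le> i'") auto
    then show "p = p'" using ll \<open>r = r'\<close> by (simp add: p)
  qed
  show "?f ` ?D \<subseteq> ?R"
    by (auto simp: lyndon_words_def in_lists_conv_set simp del: replicate_Suc)
  show "?R \<subseteq> ?f ` ?D"
  proof
    fix w assume w: "w \<in> ?R"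
    then obtain v r where v: "prime_word v" "w = concat (replicate (Suc r) v)"
      using ex_prime_root[of w] by (metis DiffD2 insertI1 gr0_conv_Suc)
    obtain i where i: "\<forall>k. lexordp_eq (rotate i v) (rotate k (rotate i v))"
      using ex_min_rotation by blast
    define l where "l = rotate i v"
    obtain j where j: "rotate j l = v" using rotate_inverse l_def by metis
    have nN: "v \<noteq> []" using v prime_word_not_Nil by auto
    have "set l \<subseteq> X" using w v by (auto simp: l_def)
    then have "l \<in> lyndon_words X"
      using i nN prime_word_rotate[OF v(1)]
      by (auto simp: lyndon_words_def l_def)
    moreover have "rotate (j mod length l) (concat (replicate (Suc r) l)) = w"
      using j v by (simp only: rotate_concat_replicate flip: rotate_conv_mod)
    ultimately show "w \<in> ?f ` ?D" using nN
      by (intro image_eqI[of _ _ "(l, r, j mod length l)"]) (auto simp: l_def simp del: replicate_Suc)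
  qed
qed

section \<open>Real parts of quaternions and the logarithm\<close>

lemma qRe_mult_commute: "qRe (x * y) = qRe (y * x)"
  by (simp add: times_quat_def)

lemma qRe_add [simp]: "qRe (x + y) = qRe x + qRe y"
  by (simp add: plus_quat_def)

lemma qRe_sum [simp]: "qRe (sum f A) = (\<Sum>x\<in>A. qRe (f x))"
  by (induction A rule: infinite_finite_induct) (simp_all add: zero_quat_def)

lemma abs_qRe_le_norm: "\<bar>qRe x\<bar> \<le> norm x"
  unfolding norm_quat_def qnorm2_def by (intro real_le_rsqrt) (simp add: power2_eq_square)

text \<open>
  Quaternions and complex numbers satisfy the same quadratic equation, with coefficients given by
  the real part and the norm. Hence the real parts of their powers obey the same two-term recursion,
  and series in those real parts can be evaluated over the complex numbers.
\<close>

lemma quat_cayley_hamilton: "x * x = scaleR (2 * qRe x) x - of_real ((norm x)\<^sup>2)"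
  by (simp add: norm_quat_def qnorm2_nonneg of_real_def)
    (simp add: times_quat_def minus_quat_def scaleR_quat_def one_quat_def quat_eq_iff
        qnorm2_def power2_eq_square algebra_simps)

lemma complex_cayley_hamilton: "z * z = scaleR (2 * Re z) z - of_real ((norm z)\<^sup>2)" for z :: complex
  using cmod_power2[of z] by (simp add: complex_eq_iff power2_eq_square)

lemma qRe_power_eq_Re_power:
  assumes "qRe x = Re z" "norm x = norm z"
  shows "qRe (x ^ n) = Re (z ^ n)"
proof (induction n rule: induct_nat_012)
  case (ge2 n)
  have q: "qRe (x * x * x ^ n) = 2 * qRe x * qRe (x ^ Suc n) - (norm x)\<^sup>2 * qRe (x ^ n)"
    by (subst quat_cayley_hamilton)
      (simp add: of_real_def algebra_simps, simp add: minus_quat_def scaleR_quat_def)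
  have "Re (z * z * z ^ n) = 2 * Re z * Re (z ^ Suc n) - (norm z)\<^sup>2 * Re (z ^ n)"
    by (subst complex_cayley_hamilton) (simp add: algebra_simps)
  with q show ?case using ge2 assms by (simp add: mult.assoc)
next
  case 0
  show ?case by (simp add: one_quat_def)
next
  case 1
  show ?case using assms by simp
qed

lemma ex_complex_same_Re_norm:
  "\<exists>z. qRe x = Re z \<and> norm x = norm z \<and> norm (1 - x) = norm (1 - z)"
  by (rule exI[of _ "Complex (qRe x) (sqrt ((qI x)\<^sup>2 + (qJ x)\<^sup>2 + (qK x)\<^sup>2))"])
    (simp add: norm_quat_def qnorm2_def cmod_def minus_quat_def one_quat_def algebra_simps)

lemma ln_one_minus_sums:
  fixes z :: complex
  assumes "norm z < 1"
  shows "(\<lambda>k. z ^ Suc k / of_nat (Suc k)) sums - ln (1 - z)"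
proof -
  have "(\<lambda>n. - (z ^ n / of_nat n)) sums ln (1 - z)"
    using Ln_series'[of "- z"] assms by simp
  from sums_minus[OF this] show ?thesis
    by (subst sums_Suc_iff) simp
qed

lemma ln_norm_one_minus_sums:
  fixes x :: quat
  assumes "norm x < 1"
  shows "(\<lambda>k. qRe (x ^ Suc k) / real (Suc k)) sums - ln (norm (1 - x))"
proof -
  obtain z where z: "qRe x = Re z" "norm x = norm z" "norm (1 - x) = norm (1 - z)"
    using ex_complex_same_Re_norm by blast
  have "(\<lambda>k. Re (z ^ Suc k / of_nat (Suc k))) sums Re (- ln (1 - z))"
    using assms z by (intro sums_Re ln_one_minus_sums) simp
  moreover have "1 - z \<noteq> 0" using assms z by auto
  moreover have "Re (z ^ Suc k / of_nat (Suc k)) = qRe (x ^ Suc k) / real (Suc k)" for k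
    by (simp only: qRe_power_eq_Re_power[OF z(1,2)] Re_divide_of_nat)
  ultimately show ?thesis
    using z(3) by simp
qed

section \<open>Traces and the logarithm of a determinant\<close>

definition mtrace :: "'a::comm_monoid_add mat \<Rightarrow> 'a" where
  "mtrace A = (\<Sum>i<dim_row A. A $$ (i, i))"

lemma index_mult_mat_sum:
  assumes "A \<in> carrier_mat n k" "B \<in> carrier_mat k m" "i < n" "j < m"
  shows "(A * B) $$ (i, j) = (\<Sum>l<k. A $$ (i, l) * B $$ (l, j))"
  using assms by (auto simp: scalar_prod_def lessThan_atLeast0)

lemma mtrace_commute:
  fixes A B :: "'a::comm_semiring_0 mat"
  assumes "A \<in> carrier_mat n n" "B \<in> carrier_mat n n"
  shows "mtrace (A * B) = mtrace (B * A)"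
proof -
  have "mtrace (A * B) = (\<Sum>i<n. \<Sum>l<n. A $$ (i, l) * B $$ (l, i))"
    using assms by (auto simp: mtrace_def index_mult_mat_sum[OF assms] simp del: index_mult_mat(1))
  also have "\<dots> = (\<Sum>l<n. \<Sum>i<n. B $$ (l, i) * A $$ (i, l))"
    by (subst sum.swap) (simp add: mult.commute)
  also have "\<dots> = mtrace (B * A)"
    using assms by (auto simp: mtrace_def index_mult_mat_sum[OF assms(2,1)] simp del: index_mult_mat(1))
  finally show ?thesis .
qed

lemma upper_triangular_pow:
  fixes B :: "'a::comm_semiring_1 mat"
  assumes B: "B \<in> carrier_mat n n" and ut: "upper_triangular B"
  shows "i < n \<Longrightarrow> j \<le> i \<Longrightarrow> (B ^\<^sub>m k) $$ (i, j) = (if i = j then (B $$ (i, i)) ^ k else 0)"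
proof (induction k arbitrary: i j)
  case (Suc k)
  have "(B ^\<^sub>m Suc k) $$ (i, j) = (\<Sum>l<n. (B ^\<^sub>m k) $$ (i, l) * B $$ (l, j))"
    using Suc.prems B index_mult_mat_sum[of "B ^\<^sub>m k" n n B n i j] by (simp del: index_mult_mat(1))
  also have "\<dots> = (\<Sum>l<n. if l = i then (B ^\<^sub>m k) $$ (i, i) * B $$ (i, j) else 0)"
  proof (intro sum.cong refl)
    fix l assume "l \<in> {..<n}"
    then consider "l < i" | "l = i" | "l > i" "B $$ (l, j) = 0"
      using Suc.prems ut B by (force simp: upper_triangular_def)
    then show "(B ^\<^sub>m k) $$ (i, l) * B $$ (l, j) = (if l = i then (B ^\<^sub>m k) $$ (i, i) * B $$ (i, j) else 0)"
      by cases (use Suc in auto)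
  qed
  also have "\<dots> = (B ^\<^sub>m k) $$ (i, i) * B $$ (i, j)"
    using Suc.prems by simp
  also have "\<dots> = (if i = j then (B $$ (i, i)) ^ Suc k else 0)"
    using Suc ut B by (auto simp: upper_triangular_def power_commutes)
  finally show ?case .
qed (use B in auto)

text \<open>
  Compare both sides of \<open>M v = e v\<close> in a coordinate where \<open>v\<close> is largest in absolute value.
\<close>

lemma norm_eigenvalue_le:
  fixes M :: "complex mat"
  assumes M: "M \<in> carrier_mat n n" and ev: "eigenvalue M e"
    and q: "\<And>i j. i < n \<Longrightarrow> j < n \<Longrightarrow> norm (M $$ (i, j)) \<le> q"
  shows "norm e \<le> real n * q"
proof -
  obtain v where v: "v \<in> carrier_vec n" "v \<noteq> 0\<^sub>v n" "M *\<^sub>v v = e \<cdot>\<^sub>v v"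
    using ev M by (auto simp: eigenvalue_def eigenvector_def)
  have "\<exists>j<n. v $ j \<noteq> 0"
  proof (rule ccontr)
    assume "\<not> (\<exists>j<n. v $ j \<noteq> 0)"
    then have "v = 0\<^sub>v n" using v(1) by (intro eq_vecI) auto
    with v(2) show False by simp
  qed
  then obtain j where j: "j < n" "v $ j \<noteq> 0" by blast
  let ?N = "(\<lambda>i. norm (v $ i)) ` {..<n}"
  have "Max ?N \<in> ?N" using j by (intro Max_in) auto
  then obtain i where i: "i < n" "norm (v $ i) = Max ?N"
    by (metis (no_types, lifting) imageE lessThan_iff)
  have max: "norm (v $ k) \<le> norm (v $ i)" if "k < n" for k
    unfolding i(2) using that by (intro Max_ge) auto
  have "e * v $ i = (\<Sum>k<n. M $$ (i, k) * v $ k)"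
    using arg_cong[OF v(3), of "\<lambda>x. x $ i"] i v(1) M
    by (simp add: scalar_prod_def lessThan_atLeast0)
  then have "norm e * norm (v $ i) = norm (\<Sum>k<n. M $$ (i, k) * v $ k)"
    by (simp flip: norm_mult)
  also have "\<dots> \<le> (\<Sum>k<n. q * norm (v $ i))"
    using q i max
    by (intro sum_norm_le) (auto simp: norm_mult intro!: mult_mono order_trans[OF norm_ge_zero q])
  also have "\<dots> = real n * q * norm (v $ i)" by simp
  finally have "norm e * norm (v $ i) \<le> real n * q * norm (v $ i)" .
  moreover have "norm (v $ i) > 0" using max[of j] j by (auto intro: less_le_trans[of _ "norm (v $ j)"])
  ultimately show ?thesis by simp
qed

text \<open>
  The identity \<open>log det (1 - M) = - (\<Sum>k\<ge>1. tr (M\<^sup>k) / k)\<close>. Triangularising \<open>M\<close> makes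
  both sides sums over the eigenvalues, where it is the series of the logarithm; the bound on the
  entries keeps all eigenvalues inside the unit disc. It is phrased through \<open>exp\<close>, since no branch of the
  logarithm of the determinant needs to be chosen.
\<close>

lemma det_one_minus_eq_exp_trace:
  fixes M :: "complex mat"
  assumes M: "M \<in> carrier_mat n n"
    and q: "\<And>i j. i < n \<Longrightarrow> j < n \<Longrightarrow> norm (M $$ (i, j)) \<le> q" and nq: "real n * q < 1"
  shows "\<exists>L. (\<lambda>k. mtrace (M ^\<^sub>m Suc k) / of_nat (Suc k)) sums L \<and> det (1\<^sub>m n - M) = exp (- L)"
proof -
  obtain es where es: "char_poly M = (\<Prod>e\<leftarrow>es. [:- e, 1:])"
    using char_poly_factorized[OF M] by blast
  obtain B P Q where "schur_decomposition M es = (B, P, Q)"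
    by (cases "schur_decomposition M es") auto
  from schur_decomposition[OF M es this]
  have sim: "similar_mat_wit M B P Q" and ut: "upper_triangular B" and dB: "diag_mat B = es"
    by auto
  note S = similar_mat_witD2[OF M sim]
  define b where "b i = B $$ (i, i)" for i
  have b: "norm (b i) < 1" if "i < n" for i
  proof -
    have "b i \<in> set es"
      using that S(5) by (auto simp: b_def diag_mat_def simp flip: dB)
    then have "poly (char_poly M) (b i) = 0"
      unfolding es by (auto simp: poly_prod_list prod_list_zero_iff)
    then have "eigenvalue M (b i)" using eigenvalue_root_char_poly[OF M] by simp
    from norm_eigenvalue_le[OF M this q] nq show ?thesis by simp
  qed
  have tr: "mtrace (M ^\<^sub>m k) = (\<Sum>i<n. b i ^ k)" for k
  proof -
    have Bk: "B ^\<^sub>m k \<in> carrier_mat n n" using S(5) by simp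
    have "mtrace (M ^\<^sub>m k) = mtrace (P * (B ^\<^sub>m k * Q))"
      using similar_mat_wit_pow_id[OF sim, of k] S Bk by simp
    also have "\<dots> = mtrace (B ^\<^sub>m k * Q * P)"
      using S Bk by (intro mtrace_commute) auto
    also have "B ^\<^sub>m k * Q * P = B ^\<^sub>m k"
      using assoc_mult_mat[OF Bk S(7,6)] right_mult_one_mat[OF Bk] S(2) by simp
    also have "mtrace (B ^\<^sub>m k) = (\<Sum>i<n. b i ^ k)"
      using upper_triangular_pow[OF S(5) ut] S(5) by (simp add: mtrace_def b_def)
    finally show ?thesis .
  qed
  have "det (1\<^sub>m n - M) = det (1\<^sub>m n - B)"
  proof -
    have "P * (1\<^sub>m n - B) * Q = P * Q - P * B * Q"
    proof -
      have "P * (1\<^sub>m n - B) = P * 1\<^sub>m n - P * B"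
        using S by (intro mult_minus_distrib_mat) auto
      also have "\<dots> * Q = P * 1\<^sub>m n * Q - P * B * Q"
        using S by (intro minus_mult_distrib_mat[of _ n n]) auto
      finally show ?thesis using right_mult_one_mat[OF S(6)] by simp
    qed
    then have "similar_mat_wit (1\<^sub>m n - M) (1\<^sub>m n - B) P Q"
      using S by (intro similar_mat_witI[of _ _ n]) auto
    then show ?thesis by (intro det_similar) (auto simp: similar_mat_def)
  qed
  also have "\<dots> = (\<Prod>i<n. 1 - b i)"
  proof -
    have "upper_triangular (1\<^sub>m n - B)"
      using ut S(5) by (auto simp: upper_triangular_def)
    then have "det (1\<^sub>m n - B) = prod_list (diag_mat (1\<^sub>m n - B))"
      using S(5) by (intro det_upper_triangular) auto
    also have "diag_mat (1\<^sub>m n - B) = map (\<lambda>i. 1 - b i) [0..<n]"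
      using S(5) by (auto simp: diag_mat_def b_def)
    finally show ?thesis by (simp add: prod.list_conv_set_nth lessThan_atLeast0)
  qed
  also have "\<dots> = exp (- (\<Sum>i<n. - ln (1 - b i)))"
  proof -
    have "1 - b i \<noteq> 0" if "i < n" for i using b[OF that] by auto
    then show ?thesis by (simp add: sum_negf exp_sum)
  qed
  finally have det: "det (1\<^sub>m n - M) = exp (- (\<Sum>i<n. - ln (1 - b i)))" .
  have "(\<lambda>k. \<Sum>i<n. b i ^ Suc k / of_nat (Suc k)) sums (\<Sum>i<n. - ln (1 - b i))"
    using b by (intro sums_sum ln_one_minus_sums) auto
  then have "(\<lambda>k. mtrace (M ^\<^sub>m Suc k) / of_nat (Suc k)) sums (\<Sum>i<n. - ln (1 - b i))"
    by (simp only: tr sum_divide_distrib)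
  with det show ?thesis by blast
qed

section \<open>The complex representation of quaternionic matrices\<close>

lemma qS_sum [simp]: "qS (sum f A) = (\<Sum>x\<in>A. qS (f x))"
  by (induction A rule: infinite_finite_induct)
    (simp_all add: qS_def zero_quat_def plus_quat_def complex_eq_iff)

lemma qP_sum [simp]: "qP (sum f A) = (\<Sum>x\<in>A. qP (f x))"
  by (induction A rule: infinite_finite_induct)
    (simp_all add: qP_def zero_quat_def plus_quat_def complex_eq_iff)

lemma qS_mult: "qS (x * y) = qS x * qS y - cnj (qP x) * qP y"
  by (simp add: qS_def qP_def times_quat_def complex_eq_iff)

lemma qP_mult: "qP (x * y) = qP x * qS y + cnj (qS x) * qP y"
  by (simp add: qS_def qP_def times_quat_def complex_eq_iff)

lemma qS_diff: "qS (x - y) = qS x - qS y" and qP_diff: "qP (x - y) = qP x - qP y"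
  by (simp_all add: qS_def qP_def minus_quat_def complex_eq_iff)

lemma qS_qP_zero_one [simp]: "qS 0 = 0" "qS 1 = 1" "qP 0 = 0" "qP 1 = 0"
  by (simp_all add: qS_def qP_def zero_quat_def one_quat_def complex_eq_iff)

lemma norm_qS_le: "norm (qS x) \<le> norm x" and norm_qP_le: "norm (qP x) \<le> norm x"
  by (simp_all add: qS_def qP_def cmod_def norm_quat_def qnorm2_def)

lemma study_psi_carrier [simp]: "A \<in> carrier_mat n n \<Longrightarrow> study_psi A \<in> carrier_mat (2 * n) (2 * n)"
  unfolding study_psi_def by auto

lemma dim_study_psi [simp]:
  "dim_row (study_psi A) = 2 * dim_row A" "dim_col (study_psi A) = 2 * dim_col A"
  by (simp_all add: study_psi_def)

lemma index_study_psi: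
  assumes "A \<in> carrier_mat n n" "i < 2 * n" "j < 2 * n"
  shows "study_psi A $$ (i, j) =
    (if i < n then if j < n then qS (A $$ (i, j)) else - cnj (qP (A $$ (i, j - n)))
     else if j < n then qP (A $$ (i - n, j)) else cnj (qS (A $$ (i - n, j - n))))"
  using assms unfolding study_psi_def by auto

lemma study_psi_one: "study_psi (1\<^sub>m n) = 1\<^sub>m (2 * n)"
  by (rule eq_matI) (auto simp: index_study_psi[of _ n])

lemma study_psi_diff:
  assumes "A \<in> carrier_mat n n" "B \<in> carrier_mat n n"
  shows "study_psi (A - B) = study_psi A - study_psi B"
proof (rule eq_matI)
  fix i j assume "i < dim_row (study_psi A - study_psi B)" "j < dim_col (study_psi A - study_psi B)"
  then have "i < 2 * n" "j < 2 * n" using assms by auto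
  then show "study_psi (A - B) $$ (i, j) = (study_psi A - study_psi B) $$ (i, j)"
    using assms index_study_psi[OF minus_carrier_mat[OF assms(2)], of i j A]
      index_study_psi[OF assms(1), of i j] index_study_psi[OF assms(2), of i j]
    by (auto simp: qS_diff qP_diff)
qed (use assms in auto)

lemma study_psi_mult:
  assumes A: "A \<in> carrier_mat n n" and B: "B \<in> carrier_mat n n"
  shows "study_psi (A * B) = study_psi A * study_psi B"
proof -
  have "study_psi A * study_psi B = four_block_mat
     (map_mat qS A * map_mat qS B + (- map_mat cnj (map_mat qP A)) * map_mat qP B)
     (map_mat qS A * (- map_mat cnj (map_mat qP B)) + (- map_mat cnj (map_mat qP A)) * map_mat cnj (map_mat qS B))
     (map_mat qP A * map_mat qS B + map_mat cnj (map_mat qS A) * map_mat qP B)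
     (map_mat qP A * (- map_mat cnj (map_mat qP B)) + map_mat cnj (map_mat qS A) * map_mat cnj (map_mat qS B))"
    unfolding study_psi_def using A B by (intro mult_four_block_mat) auto
  also have "\<dots> = study_psi (A * B)"
    unfolding study_psi_def
    by (rule arg_cong4[of _ _ _ _ _ _ _ _ four_block_mat]; rule eq_matI)
      (use A B in \<open>auto simp: scalar_prod_def qS_mult qP_mult sum.distrib sum_subtractf sum_negf\<close>)
  finally show ?thesis by simp
qed

lemma study_psi_pow:
  assumes "A \<in> carrier_mat n n"
  shows "study_psi (A ^\<^sub>m k) = study_psi A ^\<^sub>m k"
proof (induction k)
  case 0
  then show ?case using assms by (simp add: study_psi_one)
next
  case (Suc k)
  then show ?case using study_psi_mult[of "A ^\<^sub>m k" n A] assms by simp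
qed

text \<open>
  The two diagonal blocks of \<open>\<psi>(A)\<close> are complex conjugates of each other, so their imaginary parts
  cancel.
\<close>

lemma mtrace_study_psi:
  assumes "A \<in> carrier_mat n n"
  shows "mtrace (study_psi A) = of_real (2 * qRe (mtrace A))"
proof -
  have "mtrace (study_psi A) = (\<Sum>i<n + n. study_psi A $$ (i, i))"
    using assms by (simp add: mtrace_def mult_2 carrier_matD(1))
  also have "\<dots> = (\<Sum>i<n. study_psi A $$ (i, i)) + (\<Sum>i<n. study_psi A $$ (i + n, i + n))"
  proof -
    have "(\<Sum>i<n + k. f i) = (\<Sum>i<n. f i) + (\<Sum>i<k. f (i + n))" for k and f :: "nat \<Rightarrow> complex"
      by (induction k) (simp_all add: ac_simps)
    then show ?thesis .
  qed
  also have "\<dots> = (\<Sum>i<n. qS (A $$ (i, i))) + (\<Sum>i<n. cnj (qS (A $$ (i, i))))"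
    using assms by (simp add: index_study_psi[of _ n])
  also have "\<dots> = of_real (2 * qRe (mtrace A))"
    using assms by (simp add: mtrace_def complex_eq_iff qS_def sum_negf)
  finally show ?thesis .
qed

section \<open>Walks, cycles and powers of a matrix\<close>

definition path_weight :: "('i \<Rightarrow> 'i \<Rightarrow> 'a::monoid_mult) \<Rightarrow> 'i \<Rightarrow> 'i list \<Rightarrow> 'i \<Rightarrow> 'a" where
  "path_weight K i w j = prod_list (map (\<lambda>(x, y). K x y) (zip (i # w) (w @ [j])))"

definition cycle_weight :: "('i \<Rightarrow> 'i \<Rightarrow> 'a::monoid_mult) \<Rightarrow> 'i list \<Rightarrow> 'a" where
  "cycle_weight K w = prod_list (map (\<lambda>(x, y). K x y) (zip w (rotate1 w)))"

lemma path_weight_simps [simp]: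
  "path_weight K i [] j = K i j"
  "path_weight K i (x # w) j = K i x * path_weight K x w j"
  by (simp_all add: path_weight_def)

lemma cycle_weight_Cons: "cycle_weight K (i # w) = path_weight K i w i"
  by (simp add: path_weight_def cycle_weight_def)

lemma sum_words_Suc:
  assumes "finite X"
  shows "(\<Sum>w | set w \<subseteq> X \<and> length w = Suc k. f w)
       = (\<Sum>x\<in>X. \<Sum>w | set w \<subseteq> X \<and> length w = k. f (x # w))"
proof -
  let ?V = "{w. set w \<subseteq> X \<and> length w = k}"
  have "(\<Sum>w | set w \<subseteq> X \<and> length w = Suc k. f w) = (\<Sum>(w, x)\<in>?V \<times> X. f (x # w))"
    unfolding lists_length_Suc_eq by (subst sum.reindex) (auto simp: inj_on_def split_def)
  also have "\<dots> = (\<Sum>w\<in>?V. \<Sum>x\<in>X. f (x # w))"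
    by (simp add: sum.cartesian_product)
  finally show ?thesis by (subst sum.swap)
qed

lemma pow_mat_Suc_left:
  assumes "A \<in> carrier_mat n n"
  shows "A ^\<^sub>m Suc k = A * A ^\<^sub>m k"
proof (induction k)
  case 0
  then show ?case using assms by simp
next
  case (Suc k)
  have "A ^\<^sub>m Suc (Suc k) = A * A ^\<^sub>m k * A" using Suc by simp
  also have "\<dots> = A * (A ^\<^sub>m k * A)" using assms by (intro assoc_mult_mat) auto
  finally show ?case by simp
qed

text \<open>
  Letters of words start at \<open>1\<close> and matrix indices at \<open>0\<close>, hence the shift.
\<close>

definition kernel_mat :: "nat \<Rightarrow> (nat \<Rightarrow> nat \<Rightarrow> 'a) \<Rightarrow> 'a mat" where
  "kernel_mat n K = Matrix.mat n n (\<lambda>(i, j). K (Suc i) (Suc j))"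

lemma kernel_mat_carrier [simp]: "kernel_mat n K \<in> carrier_mat n n"
  by (simp add: kernel_mat_def)

lemma dim_kernel_mat [simp]: "dim_row (kernel_mat n K) = n" "dim_col (kernel_mat n K) = n"
  by (simp_all add: kernel_mat_def)

lemma index_kernel_mat [simp]:
  "i < n \<Longrightarrow> j < n \<Longrightarrow> kernel_mat n K $$ (i, j) = K (Suc i) (Suc j)"
  by (simp add: kernel_mat_def)

lemma index_kernel_mat_pow:
  fixes K :: "nat \<Rightarrow> nat \<Rightarrow> 'a::semiring_1"
  assumes "i < n" "j < n"
  shows "(kernel_mat n K ^\<^sub>m Suc k) $$ (i, j)
       = (\<Sum>w | set w \<subseteq> {1..n} \<and> length w = k. path_weight K (Suc i) w (Suc j))"
  using assms(1)
proof (induction k arbitrary: i)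
  case 0
  have "{w. set w \<subseteq> {1..n} \<and> length w = 0} = {[]}" by auto
  then show ?case using 0 assms by simp
next
  case (Suc k)
  have "(kernel_mat n K ^\<^sub>m Suc (Suc k)) $$ (i, j)
      = (\<Sum>l<n. kernel_mat n K $$ (i, l) * (kernel_mat n K ^\<^sub>m Suc k) $$ (l, j))"
    using Suc.prems assms(2)
    by (simp only: pow_mat_Suc_left[OF kernel_mat_carrier, of _ _ "Suc k"]
      index_mult_mat_sum[OF kernel_mat_carrier pow_carrier_mat[OF kernel_mat_carrier]])
  also have "\<dots> = (\<Sum>l<n. \<Sum>w | set w \<subseteq> {1..n} \<and> length w = k. path_weight K (Suc i) (Suc l # w) (Suc j))"
    using Suc.prems by (intro sum.cong refl) (simp add: Suc.IH sum_distrib_left del: pow_mat.simps)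
  also have "\<dots> = (\<Sum>x\<in>{1..n}. \<Sum>w | set w \<subseteq> {1..n} \<and> length w = k. path_weight K (Suc i) (x # w) (Suc j))"
    by (rule sum.reindex_bij_witness[of _ "\<lambda>x. x - 1" Suc]) auto
  finally show ?case by (simp only: sum_words_Suc[OF finite_atLeastAtMost])
qed

lemma mtrace_kernel_mat_pow:
  fixes K :: "nat \<Rightarrow> nat \<Rightarrow> 'a::semiring_1"
  shows "mtrace (kernel_mat n K ^\<^sub>m Suc k)
       = (\<Sum>w | set w \<subseteq> {1..n} \<and> length w = Suc k. cycle_weight K w)"
proof -
  have "mtrace (kernel_mat n K ^\<^sub>m Suc k)
      = (\<Sum>i<n. \<Sum>w | set w \<subseteq> {1..n} \<and> length w = k. cycle_weight K (Suc i # w))"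
    by (simp add: mtrace_def index_kernel_mat_pow cycle_weight_Cons del: pow_mat.simps)
  also have "\<dots> = (\<Sum>x\<in>{1..n}. \<Sum>w | set w \<subseteq> {1..n} \<and> length w = k. cycle_weight K (x # w))"
    by (rule sum.reindex_bij_witness[of _ "\<lambda>x. x - 1" Suc]) auto
  finally show ?thesis by (simp only: sum_words_Suc[OF finite_atLeastAtMost])
qed

text \<open>
  The weight of a cycle depends on its starting point, because quaternions do not commute, but its
  real part does not, by \<open>Re (x y) = Re (y x)\<close>.
\<close>

lemma qRe_prod_list_rotate: "qRe (prod_list (rotate k xs)) = qRe (prod_list xs)"
  using qRe_mult_commute[of "prod_list (drop (k mod length xs) xs)" "prod_list (take (k mod length xs) xs)"]
  by (simp add: rotate_drop_take flip: prod_list.append)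

lemma rotate_zip:
  "length xs = length ys \<Longrightarrow> rotate k (zip xs ys) = zip (rotate k xs) (rotate k ys)"
  by (simp add: rotate_drop_take drop_zip take_zip)

lemma qRe_cycle_weight_rotate: "qRe (cycle_weight K (rotate k w)) = qRe (cycle_weight K w)"
  by (simp add: cycle_weight_def rotate1_rotate_swap qRe_prod_list_rotate
      flip: rotate_zip rotate_map)

lemma cycle_weight_concat_replicate:
  fixes K :: "'i \<Rightarrow> 'i \<Rightarrow> 'a::monoid_mult"
  shows
  "cycle_weight K (concat (replicate r w)) = cycle_weight K w ^ r"
proof -
  have "zip (concat (replicate r x)) (concat (replicate r y)) = concat (replicate r (zip x y))"
    if "length x = length y" for x y :: "'i list"
    using that by (induction r) auto
  moreover have "prod_list (map f (concat (replicate r x))) = prod_list (map f x) ^ r"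
    for f :: "'i \<times> 'i \<Rightarrow> 'a" and x by (induction r) auto
  ultimately show ?thesis
    by (simp add: cycle_weight_def rotate1_concat_replicate)
qed

lemma norm_prod_list_le:
  fixes xs :: "'a::real_normed_div_algebra list"
  assumes "\<And>x. x \<in> set xs \<Longrightarrow> norm x \<le> q"
  shows "norm (prod_list xs) \<le> q ^ length xs"
  using assms
proof (induction xs)
  case (Cons x xs)
  have "0 \<le> q" by (rule order_trans[OF norm_ge_zero Cons.prems[of x]]) simp
  then show ?case using Cons by (auto simp: norm_mult intro!: mult_mono)
qed simp

lemma norm_cycle_weight_le:
  fixes K :: "'i \<Rightarrow> 'i \<Rightarrow> 'a::real_normed_div_algebra"
  assumes "\<And>x y. x \<in> X \<Longrightarrow> y \<in> X \<Longrightarrow> norm (K x y) \<le> q" "set w \<subseteq> X"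
  shows "norm (cycle_weight K w) \<le> q ^ length w"
proof -
  have "norm (cycle_weight K w) \<le> q ^ length (map (\<lambda>(x, y). K x y) (zip w (rotate1 w)))"
    unfolding cycle_weight_def
  proof (rule norm_prod_list_le)
    fix z assume "z \<in> set (map (\<lambda>(x, y). K x y) (zip w (rotate1 w)))"
    then obtain x y where "(x, y) \<in> set (zip w (rotate1 w))" "z = K x y" by auto
    then show "norm z \<le> q"
      using assms set_zip_leftD[of x y w "rotate1 w"] set_zip_rightD[of x y w "rotate1 w"] by auto
  qed
  then show ?thesis by simp
qed

lemma geometric_summable_on_words:
  assumes "finite X" "0 \<le> q" "real (card X) * q < 1"
  shows "(\<lambda>w. q ^ length w) summable_on lists X"
proof (rule nonneg_bounded_partial_sums_imp_summable_on)
  have "(\<Sum>w\<in>F. q ^ length w) \<le> 1 / (1 - real (card X) * q)" if F: "finite F" "F \<subseteq> lists X" for F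
  proof -
    obtain N where N: "\<forall>w\<in>F. length w < N"
      using F(1) finite_nat_set_iff_bounded[of "length ` F"] by auto
    let ?V = "\<lambda>k. {w. set w \<subseteq> X \<and> length w = k}"
    have "(\<Sum>w\<in>F. q ^ length w) \<le> (\<Sum>w\<in>(\<Union>k<N. ?V k). q ^ length w)"
      using F N assms finite_lists_length_eq[of X] by (intro sum_mono2) auto
    also have "\<dots> = (\<Sum>k<N. \<Sum>w\<in>?V k. q ^ length w)"
      using finite_lists_length_eq[OF assms(1)] by (intro sum.UNION_disjoint) auto
    also have "\<dots> = (\<Sum>k<N. (real (card X) * q) ^ k)"
      by (simp add: card_lists_length_eq[OF assms(1)] power_mult_distrib)
    also have "\<dots> \<le> 1 / (1 - real (card X) * q)"
      using assms by (subst sum_gp_strict) (auto intro!: divide_right_mono)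
    finally show ?thesis .
  qed
  then show "\<forall>\<^sub>F F in finite_subsets_at_top (lists X). (\<Sum>w\<in>F. q ^ length w) \<le> 1 / (1 - real (card X) * q)"
    by (intro eventually_finite_subsets_at_top_weakI)
qed (use assms in simp)

section \<open>The product over Lyndon words\<close>

text \<open>
  The trace of the \<open>k\<close>-th power of a matrix sums the weights of the closed walks of length \<open>k\<close>,
  so the logarithm of the Study determinant is a sum of weights of words.
\<close>

lemma Sdet_one_minus_kernel_mat:
  assumes K: "\<And>i j. i \<in> {1..n} \<Longrightarrow> j \<in> {1..n} \<Longrightarrow> norm (K i j) \<le> q"
    and q: "2 * real n * q < 1"
  shows "\<exists>L. (\<lambda>k. 2 * (\<Sum>w | set w \<subseteq> {1..n} \<and> length w = Suc k. qRe (cycle_weight K w)) / real (Suc k)) sums L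
           \<and> Sdet (1\<^sub>m n - kernel_mat n K) = of_real (exp (- L))"
proof -
  let ?A = "kernel_mat n K"
  let ?s = "\<lambda>k. 2 * (\<Sum>w | set w \<subseteq> {1..n} \<and> length w = Suc k. qRe (cycle_weight K w)) / real (Suc k)"
  have A: "?A \<in> carrier_mat n n" by simp
  have entry: "norm (study_psi ?A $$ (i, j)) \<le> q" if "i < 2 * n" "j < 2 * n" for i j
  proof -
    have "norm (qS (?A $$ (k, l))) \<le> q" "norm (qP (?A $$ (k, l))) \<le> q" if "k < n" "l < n" for k l
      using K[of "Suc k" "Suc l"] that norm_qS_le[of "?A $$ (k, l)"] norm_qP_le[of "?A $$ (k, l)"]
      by auto
    then show ?thesis
      using that by (subst index_study_psi[OF A]) auto
  qed
  have "real (2 * n) * q < 1" using q by simp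
  from det_one_minus_eq_exp_trace[OF study_psi_carrier[OF A] entry this]
  obtain L where L: "(\<lambda>k. mtrace (study_psi ?A ^\<^sub>m Suc k) / of_nat (Suc k)) sums L"
    "det (1\<^sub>m (2 * n) - study_psi ?A) = exp (- L)" by auto
  have mt: "mtrace (study_psi ?A ^\<^sub>m Suc k) / of_nat (Suc k) = complex_of_real (?s k)" for k
    by (simp add: mtrace_study_psi[OF pow_carrier_mat[OF A]] mtrace_kernel_mat_pow
        flip: study_psi_pow[OF A] del: pow_mat.simps of_nat_Suc)
  have sL: "(\<lambda>k. complex_of_real (?s k)) sums L" using L(1) by (simp only: mt)
  have "Im L = 0"
    using sums_unique2[OF sums_Im[OF sL], of 0] by simp
  then have "exp (- L) = of_real (exp (- Re L))"
    by (simp add: complex_eq_iff Re_exp Im_exp)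
  moreover have "Sdet (1\<^sub>m n - ?A) = exp (- L)"
    using L(2) study_psi_diff[OF one_carrier_mat A] by (simp add: Sdet_def study_psi_one)
  moreover have "?s sums Re L"
    using sums_Re[OF sL] by (simp only: Re_complex_of_real)
  ultimately show ?thesis by auto
qed

text \<open>
  The product formula for an arbitrary matrix of small quaternions. Everything is read off from one
  absolutely convergent sum, that of \<open>Re (weight w) / length w\<close> over all nonempty words \<open>w\<close>.
\<close>

lemma has_set_prod_inverse_Sdet:
  assumes K: "\<And>i j. i \<in> {1..n} \<Longrightarrow> j \<in> {1..n} \<Longrightarrow> norm (K i j) \<le> q"
    and q: "0 \<le> q" "2 * real n * q < 1"
  shows "Sdet (1\<^sub>m n - kernel_mat n K) \<noteq> 0"
    and "has_set_prod (\<lambda>l. complex_of_real (norm (1 - cycle_weight K l) powi (-2)))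
      (lyndon_words {1..n}) (inverse (Sdet (1\<^sub>m n - kernel_mat n K)))"
proof -
  let ?X = "{1..n}" and ?c = "cycle_weight K"
  let ?Lyn = "lyndon_words ?X"
  define F where "F w = qRe (?c w) / real (length w)" for w
  have c_le: "norm (?c w) \<le> q ^ length w" if "w \<in> lists ?X" for w
    using that K by (intro norm_cycle_weight_le[of ?X]) auto
  have F_le: "norm (F w) \<le> q ^ length w" if "w \<in> lists ?X - {[]}" for w
  proof -
    have "\<bar>qRe (?c w)\<bar> \<le> q ^ length w"
      using abs_qRe_le_norm[of "?c w"] c_le[of w] that by simp
    moreover have "real (length w) \<ge> 1" using that by (cases w) auto
    ultimately show ?thesis
      using mult_left_mono[of 1 "real (length w)" "q ^ length w"] q
      by (simp add: F_def divide_le_eq)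
  qed
  have "real (card ?X) * q < 1" using q by simp
  then have "(\<lambda>w. q ^ length w) summable_on lists ?X"
    using q by (intro geometric_summable_on_words) auto
  then have "(\<lambda>w. q ^ length w) summable_on (lists ?X - {[]})"
    by (rule summable_on_subset_banach) auto
  then have "F abs_summable_on (lists ?X - {[]})"
    using F_le by (rule abs_summable_on_comparison_test')
  then obtain S where S: "(F has_sum S) (lists ?X - {[]})"
    using abs_summable_summable[of F] unfolding summable_on_def by blast

  \<comment> \<open>grouped by length, the sum is the trace series of the logarithm of the determinant\<close>
  have "Sdet (1\<^sub>m n - kernel_mat n K) = of_real (exp (- (2 * S)))"
  proof -
    let ?V = "\<lambda>k. {w. set w \<subseteq> ?X \<and> length w = Suc k}"
    have "bij_betw snd (SIGMA k:UNIV. ?V k) (lists ?X - {[]})"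
      by (rule bij_betw_byWitness[where f' = "\<lambda>w. (length w - 1, w)"]) auto
    then have "((\<lambda>p. F (snd p)) has_sum S) (SIGMA k:UNIV. ?V k)"
      using S by (simp only: has_sum_reindex_bij_betw)
    then have "((\<lambda>k. \<Sum>w\<in>?V k. F w) has_sum S) UNIV"
      by (rule has_sum_SigmaD) (simp add: has_sum_finite finite_lists_length_eq)
    then have "(\<lambda>k. 2 * (\<Sum>w\<in>?V k. F w)) sums (2 * S)"
      by (intro sums_mult has_sum_imp_sums)
    moreover have "2 * (\<Sum>w\<in>?V k. F w) = 2 * (\<Sum>w\<in>?V k. qRe (?c w)) / real (Suc k)" for k
      by (simp add: F_def flip: sum_divide_distrib)
    ultimately show ?thesis
      using Sdet_one_minus_kernel_mat[of n K q, OF K q(2)] by (auto dest: sums_unique2)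
  qed
  then have inv: "inverse (Sdet (1\<^sub>m n - kernel_mat n K)) = of_real (exp (2 * S))"
    by (simp add: exp_minus)
  then show "Sdet (1\<^sub>m n - kernel_mat n K) \<noteq> 0" by auto

  have c_less: "norm (?c l) < 1" if "l \<in> ?Lyn" for l
  proof -
    have l: "l \<in> lists ?X" "l \<noteq> []" using that by (auto simp: lyndon_words_def)
    then have "n \<ge> 1" by (cases l) auto
    then have "q < 1" using q mult_right_mono[of 1 "2 * real n" q] by linarith
    then have "q ^ length l < 1" using q l by (simp add: power_less_one_iff)
    with c_le[OF l(1)] show ?thesis by simp
  qed
  \<comment> \<open>grouped by Lyndon word, the \<open>length l\<close> rotations of \<open>l\<^sup>r\<close> contribute \<open>Re (c\<^sup>r) / r\<close> with
    \<open>c\<close> the weight of \<open>l\<close>, and summing over \<open>r\<close> gives the logarithm of one factor\<close>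
  define g where "g l = - ln (norm (1 - ?c l))" for l
  have "(g has_sum S) ?Lyn"
  proof (rule has_sum_SigmaD)
    show all: "((\<lambda>(l, r, i). F (rotate i (concat (replicate (Suc r) l)))) has_sum S)
        (SIGMA l:?Lyn. UNIV \<times> {..<length l})"
      using S unfolding has_sum_reindex_bij_betw[OF bij_betw_lyndon_power_rotations, symmetric]
      by (simp only: split_def)
    fix l assume l: "l \<in> ?Lyn"
    then have l0: "length l > 0" by (simp add: lyndon_words_def)
    let ?h = "\<lambda>r. qRe (?c l ^ Suc r) / real (Suc r)"
    have F: "F (rotate i (concat (replicate (Suc r) l))) = ?h r / real (length l)" for i r
      by (simp only: F_def qRe_cycle_weight_rotate cycle_weight_concat_replicate
          length_rotate length_concat_replicate of_nat_mult divide_divide_eq_left)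
    have "summable (\<lambda>r. norm (?h r))"
    proof (rule summable_comparison_test'[where N = 0])
      show "summable (\<lambda>r. norm (?c l) ^ Suc r)"
        using c_less[OF l] by (simp add: summable_mult summable_geometric)
      show "norm (norm (?h r)) \<le> norm (?c l) ^ Suc r" for r
      proof -
        have "\<bar>qRe (?c l ^ Suc r)\<bar> \<le> norm (?c l) ^ Suc r"
          using abs_qRe_le_norm[of "?c l ^ Suc r"] by (simp only: norm_power)
        then have "\<bar>qRe (?c l ^ Suc r)\<bar> / real (Suc r) \<le> norm (?c l) ^ Suc r / 1"
          by (intro frac_le) auto
        then show ?thesis by (simp del: power_Suc)
      qed
    qed
    moreover have "?h sums g l"
      unfolding g_def by (rule ln_norm_one_minus_sums[OF c_less[OF l]])
    ultimately have h: "(?h has_sum g l) UNIV"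
      by (rule norm_summable_imp_has_sum)
    show "((\<lambda>y. case (l, y) of (l, r, i) \<Rightarrow> F (rotate i (concat (replicate (Suc r) l)))) has_sum g l)
        (UNIV \<times> {..<length l})"
    proof (rule has_sum_SigmaI[OF _ h])
      show "((\<lambda>i. case (l, r, i) of (l, r, i) \<Rightarrow> F (rotate i (concat (replicate (Suc r) l))))
          has_sum ?h r) {..<length l}" for r
        using l0 by (intro has_sum_finiteI) (simp_all add: F del: replicate_Suc power_Suc of_nat_Suc)
      show "(\<lambda>y. case (l, y) of (l, r, i) \<Rightarrow> F (rotate i (concat (replicate (Suc r) l))))
          summable_on UNIV \<times> {..<length l}"
        using summable_on_SigmaD1[of "\<lambda>l (r, i). F (rotate i (concat (replicate (Suc r) l)))"
            ?Lyn "\<lambda>l. UNIV \<times> {..<length l}" l] all l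
        by (auto simp: summable_on_def split_def)
    qed
  qed
  then have "((\<lambda>A. complex_of_real (exp (2 * sum g A))) \<longlongrightarrow> of_real (exp (2 * S)))
      (finite_subsets_at_top ?Lyn)"
    unfolding has_sum_def by (intro tendsto_intros)
  moreover have "complex_of_real (exp (2 * sum g A))
      = (\<Prod>l\<in>A. complex_of_real (norm (1 - ?c l) powi (-2)))"
    if A: "finite A" "A \<subseteq> ?Lyn" for A
  proof -
    have "exp (2 * g l) = norm (1 - ?c l) powi (-2)" if "l \<in> A" for l
    proof -
      have "1 - ?c l \<noteq> 0" using c_less[of l] that A by auto
      then have "exp (ln (norm (1 - ?c l))) = norm (1 - ?c l)" by simp
      then have "exp (- (2 * ln (norm (1 - ?c l)))) = inverse (norm (1 - ?c l) ^ 2)"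
        by (simp add: exp_minus exp_double)
      then show ?thesis by (simp add: g_def power_int_minus)
    qed
    then show ?thesis using A
      by (simp add: sum_distrib_left exp_sum)
  qed
  ultimately show "has_set_prod (\<lambda>l. complex_of_real (norm (1 - ?c l) powi (-2)))
      ?Lyn (inverse (Sdet (1\<^sub>m n - kernel_mat n K)))"
    unfolding has_set_prod_def inv
    by (auto elim!: Lim_transform_eventually intro!: eventually_finite_subsets_at_top_weakI)
qed

theorem theorem5p5:
  fixes G :: "'v pair_pre_digraph"
    and W :: "'v \<Rightarrow> 'v \<Rightarrow> quat"
    and m :: nat
  assumes "pair_graph G"
    and "Digraph_Component.connected (with_proj G)"
    and "m = card (uedges G)"
    and "weighted_matrix G W"
  shows "\<exists>\<epsilon>>0. \<forall>a. bij_betw a {1..2 * m} (parcs G) \<longrightarrow>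
           (\<forall>t::quat. norm t < \<epsilon> \<longrightarrow>
              Sdet (zeta_mat G W a t) \<noteq> 0 \<and>
              has_set_prod
                (\<lambda>w. complex_of_real (norm (1 - cyclic_weight W a t w) powi (-2)))
                (lyndon_words {1..2 * m})
                (zeta_H G W a t))"
proof -
  interpret pair_graph G by fact
  define C where "C = (\<Sum>e\<in>parcs G. \<Sum>f\<in>parcs G. norm (wtilde W e f))"
  have C: "norm (wtilde W e f) \<le> C" if "e \<in> parcs G" "f \<in> parcs G" for e f
  proof -
    have "norm (wtilde W e f) \<le> (\<Sum>f\<in>parcs G. norm (wtilde W e f))"
      using that by (intro member_le_sum) auto
    also have "\<dots> \<le> C"
      unfolding C_def
      using that member_le_sum[of e "parcs G" "\<lambda>e. \<Sum>f\<in>parcs G. norm (wtilde W e f)"]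
      by (simp add: sum_nonneg)
    finally show ?thesis .
  qed
  have "C \<ge> 0" unfolding C_def by (intro sum_nonneg) auto
  \<comment> \<open>the bound \<open>2 * (2 * m) * (norm t * C) < 1\<close> is wanted; the summands \<open>1\<close> keep the
    denominator positive when there are no arcs or no weights\<close>
  define \<epsilon> where "\<epsilon> = 1 / ((4 * real m + 1) * (C + 1))"
  have eps: "\<epsilon> > 0" using \<open>C \<ge> 0\<close> by (simp add: \<epsilon>_def)
  show ?thesis
  proof (intro exI[of _ \<epsilon>] conjI eps allI impI)
    fix a :: "nat \<Rightarrow> 'v \<times> 'v" and t :: quat
    assume a: "bij_betw a {1..2 * m} (parcs G)" and t: "norm t < \<epsilon>"
    let ?K = "\<lambda>i j. t * wtilde W (a i) (a j)"
    have K: "norm (?K i j) \<le> norm t * C" if "i \<in> {1..2 * m}" "j \<in> {1..2 * m}" for i j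
      using that a by (auto simp: norm_mult intro!: mult_left_mono C dest: bij_betwE)
    have q: "0 \<le> norm t * C" "2 * real (2 * m) * (norm t * C) < 1"
    proof -
      have "2 * real (2 * m) * (norm t * C) \<le> (4 * real m * C) * \<epsilon>"
        using mult_left_mono[of "norm t" \<epsilon> "4 * real m * C"] t \<open>C \<ge> 0\<close> by (simp add: mult_ac)
      also have "\<dots> < ((4 * real m + 1) * (C + 1)) * \<epsilon>"
        using \<open>C \<ge> 0\<close> eps by (intro mult_strict_right_mono) (simp_all add: algebra_simps add_nonneg_pos)
      also have "\<dots> = 1" using \<open>C \<ge> 0\<close> by (simp add: \<epsilon>_def)
      finally show "2 * real (2 * m) * (norm t * C) < 1" .
    qed (use \<open>C \<ge> 0\<close> in simp)
    have Z: "zeta_mat G W a t = 1\<^sub>m (2 * m) - kernel_mat (2 * m) ?K"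
      by (rule eq_matI) (auto simp: zeta_mat_def Let_def assms(3) arc_mat_def kernel_mat_def wtilde_def)
    have cw: "cyclic_weight W a t = cycle_weight ?K"
      by (simp add: fun_eq_iff cyclic_weight_def cycle_weight_def)
    show "Sdet (zeta_mat G W a t) \<noteq> 0"
      unfolding Z by (rule has_set_prod_inverse_Sdet[OF K q])
    show "has_set_prod (\<lambda>w. complex_of_real (norm (1 - cyclic_weight W a t w) powi (-2)))
        (lyndon_words {1..2 * m}) (zeta_H G W a t)"
      unfolding zeta_H_def Z cw by (rule has_set_prod_inverse_Sdet[OF K q])
  qed
qed

end
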